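(* Let $p\ge 1$ and let $0 =: k_0 < k_1 < \cdots < k_p < k_{p+1} := n$ be integers, and set $n_{i+1} := k_{i+1}-k_i$ for $i=0,\dots,p$. For generic $(a_1,\dots,a_{p+1})\in\mathbb{R}^{p+1}$, $$\operatorname{Flag}_{a_1,\dots,a_{p+1}}(k_1,\dots,k_p,n) = \Bigl\{ X\in\mathsf{S}^2(\mathbb{R}^n) : \prod_{j=0}^{p}(X-a_{j+1}I_n)=0,\ \operatorname{tr}(X)=\sum_{j=0}^{p} n_{j+1}a_{j+1}\Bigr\}.$$
   Context: $\mathsf{S}^2(\mathbb{R}^n)$ is the space of real symmetric $n\times n$ matrices. For distinct $a_1,\dots,a_{p+1}\in\mathbb{R}$, $$\operatorname{Flag}_{a_1,\dots,a_{p+1}}(k_1,\dots,k_p,n) := \Bigl\{ X\in \mathsf{S}^2(\mathbb{R}^n) : \prod_{j=0}^{p} (X - a_{j+1} I_n) = 0,\ \operatorname{tr}(X^i) = \sum_{j=0}^{p} n_{j+1} a_{j+1}^i,\ i=1,\dots,p \Bigr\}.$$ A property holds for generic $a\in\mathbb{R}^{p+1}$ if there is a nonempty Zariski-open subset of $\mathbb{R}^{p+1}$ (the complement of the zero set of finitely many real polynomials, not all zero) all of whose points have distinct coordinates and satisfy the property; this subset may depend on $n$ and $k_1,\dots,k_p$. *)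

theory Defs
  imports
    Complex_Main
    "HOL-Library.FuncSet"
    "HOL-Library.Poly_Mapping"
    "Jordan_Normal_Form.Matrix"
begin

section \<open>Generic points\<close>

text \<open>
  A polynomial in variables \<open>x\<^sub>i\<close> with \<open>i :: nat\<close> is a finitely supported map from monomials to
  coefficients, a monomial being a finitely supported map from variables to exponents.
\<close>

type_synonym real_mpoly = "(nat \<Rightarrow>\<^sub>0 nat) \<Rightarrow>\<^sub>0 real"

definition mpoly_vars :: "real_mpoly \<Rightarrow> nat set" where
  "mpoly_vars f = (\<Union>m\<in>Poly_Mapping.keys f. Poly_Mapping.keys m)"

definition mpoly_eval :: "real_mpoly \<Rightarrow> (nat \<Rightarrow> real) \<Rightarrow> real" where
  "mpoly_eval f a =
    (\<Sum>m\<in>Poly_Mapping.keys f. Poly_Mapping.lookup f m *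
      (\<Prod>i\<in>Poly_Mapping.keys m. a i ^ Poly_Mapping.lookup m i))"

text \<open>
  The affine space \<open>\<real>\<^sup>I\<close> consists of the extensional functions on \<open>I\<close>, so its points carry no
  information besides their coordinates indexed by \<open>I\<close>.
\<close>

abbreviation real_space :: "nat set \<Rightarrow> (nat \<Rightarrow> real) set" where
  "real_space I \<equiv> I \<rightarrow>\<^sub>E (UNIV :: real set)"

definition zariski_open :: "nat set \<Rightarrow> (nat \<Rightarrow> real) set \<Rightarrow> bool" where
  "zariski_open I U \<longleftrightarrow>
    (\<exists>F. finite F \<and> (\<forall>f\<in>F. mpoly_vars f \<subseteq> I) \<and>
      U = real_space I - {a. \<forall>f\<in>F. mpoly_eval f a = 0})"

text \<open>
  Nonemptiness of \<open>U\<close> forces the defining polynomials not to be all zero; since the reals are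
  infinite, the two conditions are equivalent.
\<close>

definition holds_generically :: "nat set \<Rightarrow> ((nat \<Rightarrow> real) \<Rightarrow> bool) \<Rightarrow> bool" where
  "holds_generically I P \<longleftrightarrow>
    (\<exists>U. zariski_open I U \<and> U \<noteq> {} \<and> (\<forall>a\<in>U. inj_on a I \<and> P a))"


section \<open>The flag variety as a set of symmetric matrices\<close>

definition sym_mats :: "nat \<Rightarrow> real mat set" where
  "sym_mats n = {X \<in> carrier_mat n n. transpose_mat X = X}"

definition mat_trace :: "real mat \<Rightarrow> real" where
  "mat_trace X = (\<Sum>i<dim_row X. X $$ (i, i))"

text \<open>
  The product \<open>(X - a\<^sub>1 I\<^sub>n) \<cdots> (X - a\<^bsub>p+1\<^esub> I\<^sub>n)\<close>; the factors commute, so the order chosen here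
  is immaterial.
\<close>

definition shift_prod :: "nat \<Rightarrow> nat \<Rightarrow> (nat \<Rightarrow> real) \<Rightarrow> real mat \<Rightarrow> real mat" where
  "shift_prod p n a X =
    foldr (\<lambda>j M. (X - a (j + 1) \<cdot>\<^sub>m 1\<^sub>m n) * M) [0..<p + 1] (1\<^sub>m n)"

text \<open>
  The dimensions are given by \<open>k 0 = 0 < k 1 < \<dots> < k p < k (p + 1) = n\<close>, and the multiplicity
  \<open>n\<^bsub>j+1\<^esub>\<close> of \<open>a\<^bsub>j+1\<^esub>\<close> is \<open>k (j + 1) - k j\<close>.
\<close>

definition flag_model :: "nat \<Rightarrow> (nat \<Rightarrow> nat) \<Rightarrow> (nat \<Rightarrow> real) \<Rightarrow> real mat set" where
  "flag_model p k a =
    (let n = k (p + 1) in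
      {X \<in> sym_mats n.
        shift_prod p n a X = 0\<^sub>m n n \<and>
        (\<forall>i\<in>{1..p}. mat_trace (X ^\<^sub>m i) = (\<Sum>j=0..p. real (k (j + 1) - k j) * a (j + 1) ^ i))})"

end

theory Submission
  imports Defs "Jordan_Normal_Form.Schur_Decomposition"
begin

text \<open>
  Let \<open>X\<close> be a matrix of size \<open>n\<close> annihilated by \<open>\<Prod>\<^sub>j (X - a\<^sub>j)\<close> with distinct \<open>a\<^sub>j\<close>.
  Its spectrum lies among the \<open>a\<^sub>j\<close>, so if \<open>m\<^sub>j\<close> denotes the algebraic multiplicity of \<open>a\<^sub>j\<close> as
  an eigenvalue, then \<open>tr (X ^ r) = \<Sum>\<^sub>j m\<^sub>j a\<^sub>j ^ r\<close> for every \<open>r\<close>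
  (\<open>shift_prod_imp_power_traces\<close>). The case \<open>r = 0\<close> says that the \<open>m\<^sub>j\<close> add up to \<open>n\<close>; hence
  only finitely many vectors \<open>m\<close> can occur. With \<open>d\<^sub>j = k\<^sub>j - k\<^bsub>j-1\<^esub>\<close>, prescribing
  \<open>tr X = \<Sum>\<^sub>j d\<^sub>j a\<^sub>j\<close> means \<open>\<Sum>\<^sub>j (m\<^sub>j - d\<^sub>j) a\<^sub>j = 0\<close>, which for \<open>m \<noteq> d\<close> confines \<open>a\<close> to
  a hyperplane. Away from these finitely many hyperplanes \<open>m = d\<close>, and all the power traces have
  the prescribed values.

  The coordinates of \<open>a\<close> are distinct away from the hyperplanes \<open>x\<^sub>s = x\<^sub>t\<close>, so the genericity
  condition is altogether the nonvanishing of finitely many nonzero linear forms. That this is a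
  nonempty Zariski-open condition is shown by \<open>zariski_open_avoiding_hyperplanes\<close> and
  \<open>ex_point_avoiding_hyperplanes\<close>.
\<close>


section \<open>Polynomial functions on affine space\<close>

definition monomial_value :: "(nat \<Rightarrow>\<^sub>0 nat) \<Rightarrow> (nat \<Rightarrow> real) \<Rightarrow> real" where
  "monomial_value m a = (\<Prod>i\<in>Poly_Mapping.keys m. a i ^ Poly_Mapping.lookup m i)"

lemma monomial_value_superset:
  assumes "finite S" "Poly_Mapping.keys m \<subseteq> S"
  shows "monomial_value m a = (\<Prod>i\<in>S. a i ^ Poly_Mapping.lookup m i)"
  unfolding monomial_value_def
  by (rule prod.mono_neutral_left) (use assms in \<open>auto simp: in_keys_iff\<close>)

lemma monomial_value_add: "monomial_value (m + m') a = monomial_value m a * monomial_value m' a"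
proof -
  let ?S = "Poly_Mapping.keys m \<union> Poly_Mapping.keys m'"
  have "Poly_Mapping.keys (m + m') \<subseteq> ?S" by (rule Poly_Mapping.keys_add)
  then show ?thesis
    by (simp add: monomial_value_superset[of ?S] lookup_add power_add prod.distrib)
qed

lemma mpoly_eval_superset:
  assumes "finite S" "Poly_Mapping.keys f \<subseteq> S"
  shows "mpoly_eval f a = (\<Sum>m\<in>S. Poly_Mapping.lookup f m * monomial_value m a)"
  unfolding mpoly_eval_def monomial_value_def
  by (rule sum.mono_neutral_left) (use assms in \<open>auto simp: in_keys_iff\<close>)

lemma mpoly_eval_zero: "mpoly_eval 0 a = 0"
  by (simp add: mpoly_eval_def)

lemma mpoly_eval_add: "mpoly_eval (f + g) a = mpoly_eval f a + mpoly_eval g a"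
proof -
  let ?S = "Poly_Mapping.keys f \<union> Poly_Mapping.keys g"
  have "Poly_Mapping.keys (f + g) \<subseteq> ?S" by (rule Poly_Mapping.keys_add)
  then show ?thesis
    by (simp add: mpoly_eval_superset[of ?S] lookup_add sum.distrib distrib_right)
qed

lemma mpoly_eval_sum: "mpoly_eval (sum f A) a = (\<Sum>i\<in>A. mpoly_eval (f i) a)"
  by (induction A rule: infinite_finite_induct) (auto simp: mpoly_eval_zero mpoly_eval_add)

lemma mpoly_eval_single: "mpoly_eval (Poly_Mapping.single m c) a = c * monomial_value m a"
  by (simp add: mpoly_eval_superset[of "{m}"])

lemma poly_mapping_eq_sum_single:
  "f = (\<Sum>m\<in>Poly_Mapping.keys f. Poly_Mapping.single m (Poly_Mapping.lookup f m))"
  by (rule poly_mapping_eqI)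
    (auto simp: lookup_sum lookup_single when_def in_keys_iff sum.delta)

text \<open>
  Both sides are biadditive, so it is enough to compare them on monomials, where evaluation turns
  the addition of exponents into multiplication.
\<close>

lemma mpoly_eval_mult: "mpoly_eval (f * g) a = mpoly_eval f a * mpoly_eval g a"
proof -
  let ?s = "\<lambda>h m. Poly_Mapping.single m (Poly_Mapping.lookup h m)"
  let ?F = "Poly_Mapping.keys f" and ?G = "Poly_Mapping.keys g"
  have "f * g = sum (?s f) ?F * sum (?s g) ?G"
    using poly_mapping_eq_sum_single[of f] poly_mapping_eq_sum_single[of g] by simp
  also have "\<dots> = (\<Sum>m\<in>?F. \<Sum>l\<in>?G. ?s f m * ?s g l)"
    by (rule sum_product)
  also have "mpoly_eval \<dots> a = (\<Sum>m\<in>?F. \<Sum>l\<in>?G. mpoly_eval (?s f m) a * mpoly_eval (?s g l) a)"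
    by (simp add: mpoly_eval_sum mult_single mpoly_eval_single monomial_value_add mult_ac)
  also have "\<dots> = mpoly_eval (sum (?s f) ?F) a * mpoly_eval (sum (?s g) ?G) a"
    by (simp add: mpoly_eval_sum sum_product)
  finally show ?thesis
    by (simp flip: poly_mapping_eq_sum_single)
qed

lemma mpoly_eval_one: "mpoly_eval 1 a = 1"
  by (simp add: mpoly_eval_superset[of "{0}"] monomial_value_def lookup_one)

lemma mpoly_eval_prod: "mpoly_eval (prod f A) a = (\<Prod>i\<in>A. mpoly_eval (f i) a)"
  by (induction A rule: infinite_finite_induct) (auto simp: mpoly_eval_one mpoly_eval_mult)

lemma mpoly_vars_mult: "mpoly_vars (f * g) \<subseteq> mpoly_vars f \<union> mpoly_vars g"
proof
  fix i assume "i \<in> mpoly_vars (f * g)"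
  then obtain m where m: "m \<in> Poly_Mapping.keys (f * g)" "i \<in> Poly_Mapping.keys m"
    by (auto simp: mpoly_vars_def)
  then obtain u v where "m = u + v" "u \<in> Poly_Mapping.keys f" "v \<in> Poly_Mapping.keys g"
    using Poly_Mapping.keys_mult[of f g] by blast
  with m(2) Poly_Mapping.keys_add[of u v] show "i \<in> mpoly_vars f \<union> mpoly_vars g"
    by (auto simp: mpoly_vars_def)
qed

lemma mpoly_vars_prod:
  assumes "\<And>i. i \<in> A \<Longrightarrow> mpoly_vars (f i) \<subseteq> V"
  shows "mpoly_vars (prod f A) \<subseteq> V"
  using assms
proof (induction A rule: infinite_finite_induct)
  case (insert i A)
  then show ?case using mpoly_vars_mult[of "f i" "prod f A"] by auto
qed (auto simp: mpoly_vars_def)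

definition linear_form :: "nat set \<Rightarrow> (nat \<Rightarrow> real) \<Rightarrow> real_mpoly" where
  "linear_form I c = (\<Sum>i\<in>I. Poly_Mapping.single (Poly_Mapping.single i 1) (c i))"

lemma mpoly_eval_linear_form: "mpoly_eval (linear_form I c) a = (\<Sum>i\<in>I. c i * a i)"
  by (simp add: linear_form_def mpoly_eval_sum mpoly_eval_single monomial_value_def)

lemma mpoly_vars_linear_form: "mpoly_vars (linear_form I c) \<subseteq> I"
proof -
  have "Poly_Mapping.keys (linear_form I c) \<subseteq> (\<lambda>i. Poly_Mapping.single i 1) ` I"
    unfolding linear_form_def using Poly_Mapping.keys_sum by (fastforce split: if_splits)
  then show ?thesis by (force simp: mpoly_vars_def split: if_splits)
qed


section \<open>Avoiding finitely many hyperplanes\<close>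

text \<open>
  The points off all the hyperplanes are the nonvanishing locus of a single polynomial, the product
  of the linear forms.
\<close>

lemma zariski_open_avoiding_hyperplanes:
  assumes "finite C"
  shows "zariski_open I {a \<in> real_space I. \<forall>c\<in>C. (\<Sum>i\<in>I. c i * a i) \<noteq> 0}"
proof -
  let ?f = "prod (linear_form I) C"
  have "mpoly_vars ?f \<subseteq> I"
    by (rule mpoly_vars_prod) (rule mpoly_vars_linear_form)
  moreover have "mpoly_eval ?f a = 0 \<longleftrightarrow> (\<exists>c\<in>C. (\<Sum>i\<in>I. c i * a i) = 0)" for a
    using assms by (simp add: mpoly_eval_prod mpoly_eval_linear_form)
  ultimately show ?thesis
    unfolding zariski_open_def by (intro exI[of _ "{?f}"]) auto
qed

text \<open>
  On the moment curve \<open>i \<mapsto> x ^ i\<close> a linear form becomes a polynomial in \<open>x\<close> with the same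
  coefficients, so each of the finitely many forms excludes only finitely many values of \<open>x\<close>.
\<close>

lemma ex_point_avoiding_hyperplanes:
  assumes I: "finite I" and C: "finite C" and nz: "\<And>c. c \<in> C \<Longrightarrow> \<exists>i\<in>I. c i \<noteq> (0::real)"
  shows "\<exists>a\<in>real_space I. \<forall>c\<in>C. (\<Sum>i\<in>I. c i * a i) \<noteq> 0"
proof -
  define q where "q c = (\<Sum>i\<in>I. Polynomial.monom (c i) i)" for c :: "nat \<Rightarrow> real"
  have "q c \<noteq> 0" if "c \<in> C" for c
  proof -
    obtain i where i: "i \<in> I" "c i \<noteq> 0" using nz \<open>c \<in> C\<close> by blast
    then have "Polynomial.coeff (q c) i = c i"
      using I by (simp add: q_def Polynomial.coeff_sum sum.delta)
    with i show ?thesis by auto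
  qed
  then have "finite (\<Union>c\<in>C. {x. poly (q c) x = 0})"
    using C by (auto intro: poly_roots_finite)
  then obtain x where x: "x \<notin> (\<Union>c\<in>C. {x. poly (q c) x = 0})"
    using ex_new_if_finite[OF infinite_UNIV_char_0] by blast
  have "poly (q c) x = (\<Sum>i\<in>I. c i * restrict (\<lambda>i. x ^ i) I i)" for c
    by (simp add: q_def poly_sum poly_monom)
  with x show ?thesis
    by (intro bexI[of _ "restrict (\<lambda>i. x ^ i) I"]) auto
qed


section \<open>Power traces of a matrix annihilated by a split polynomial\<close>

lemma trace_mult_commute:
  fixes A B :: "'a::comm_semiring_0 mat"
  assumes "A \<in> carrier_mat n n" "B \<in> carrier_mat n n"
  shows "(\<Sum>i<n. (A * B) $$ (i, i)) = (\<Sum>i<n. (B * A) $$ (i, i))"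
proof -
  have "(\<Sum>i<n. (A * B) $$ (i, i)) = (\<Sum>i<n. \<Sum>j<n. A $$ (i, j) * B $$ (j, i))"
    using assms by (simp add: scalar_prod_def lessThan_atLeast0)
  also have "\<dots> = (\<Sum>j<n. \<Sum>i<n. B $$ (j, i) * A $$ (i, j))"
    by (subst sum.swap) (simp add: mult.commute)
  also have "\<dots> = (\<Sum>j<n. (B * A) $$ (j, j))"
    using assms by (simp add: scalar_prod_def lessThan_atLeast0)
  finally show ?thesis .
qed

lemma trace_similar:
  fixes A :: "'a::comm_semiring_1 mat"
  assumes A: "A \<in> carrier_mat n n" and wit: "similar_mat_wit A B P Q"
  shows "(\<Sum>i<n. A $$ (i, i)) = (\<Sum>i<n. B $$ (i, i))"
proof -
  note w = similar_mat_witD2[OF A wit]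
  have "(\<Sum>i<n. A $$ (i, i)) = (\<Sum>i<n. (Q * (P * B)) $$ (i, i))"
    unfolding w(3) by (rule trace_mult_commute) (use w in auto)
  also have "Q * (P * B) = B"
    using w by (simp add: assoc_mult_mat[symmetric, of Q n n P n B n])
  finally show ?thesis .
qed

lemma upper_triangular_mult_diag:
  fixes A B :: "'a::semiring_0 mat"
  assumes A: "A \<in> carrier_mat n n" "upper_triangular A"
    and B: "B \<in> carrier_mat n n" "upper_triangular B"
  shows "upper_triangular (A * B)"
    and "i < n \<Longrightarrow> (A * B) $$ (i, i) = A $$ (i, i) * B $$ (i, i)"
proof -
  have entry: "(A * B) $$ (i, j) = (\<Sum>l<n. A $$ (i, l) * B $$ (l, j))" if "i < n" "j < n" for i j
    using A B that by (simp add: scalar_prod_def lessThan_atLeast0)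
  have zero: "A $$ (i, l) * B $$ (l, j) = 0" if "l < n" "i < n" "j < n" "l < i \<or> j < l" for i j l
    using that A B by (auto simp: upper_triangular_def)
  show "upper_triangular (A * B)"
  proof
    fix i j assume "j < i" "i < dim_row (A * B)"
    with A have "i < n" "j < n" "j < i" by auto
    moreover from this have "(\<Sum>l<n. A $$ (i, l) * B $$ (l, j)) = 0"
      by (intro sum.neutral ballI zero) auto
    ultimately show "(A * B) $$ (i, j) = 0" by (simp only: entry)
  qed
  show "(A * B) $$ (i, i) = A $$ (i, i) * B $$ (i, i)" if i: "i < n"
  proof -
    have "(\<Sum>l<n. A $$ (i, l) * B $$ (l, i)) = (\<Sum>l\<in>{i}. A $$ (i, l) * B $$ (l, i))"
      by (rule sum.mono_neutral_right) (use i zero[of _ i i] in \<open>auto simp: neq_iff\<close>)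
    with i show ?thesis by (simp add: entry)
  qed
qed

lemma upper_triangular_pow_diag:
  fixes A :: "'a::semiring_1 mat"
  assumes A: "A \<in> carrier_mat n n" "upper_triangular A"
  shows "upper_triangular (A ^\<^sub>m r) \<and> (\<forall>i<n. (A ^\<^sub>m r) $$ (i, i) = (A $$ (i, i)) ^ r)"
proof (induction r)
  case 0
  show ?case using A by simp
next
  case (Suc r)
  then show ?case
    using upper_triangular_mult_diag[OF pow_carrier_mat[OF A(1)] _ A]
    by (auto simp: power_commutes)
qed

text \<open>
  An eigenvector for \<open>e\<close> is scaled by \<open>\<Prod>\<^sub>z (e - z)\<close> under the product of the \<open>A - z\<close>, so this scalar
  vanishes when the product does.
\<close>

lemma eigenvalue_of_annihilated:
  fixes A :: "'a::field mat"
  assumes A: "A \<in> carrier_mat n n"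
    and ann: "foldr (\<lambda>z M. (A - z \<cdot>\<^sub>m 1\<^sub>m n) * M) zs (1\<^sub>m n) = 0\<^sub>m n n"
    and e: "eigenvalue A e"
  shows "e \<in> set zs"
proof -
  obtain v where v: "v \<in> carrier_vec n" "v \<noteq> 0\<^sub>v n" "A *\<^sub>v v = e \<cdot>\<^sub>v v"
    using e A by (auto simp: eigenvalue_def eigenvector_def)
  let ?S = "\<lambda>zs. foldr (\<lambda>z M. (A - z \<cdot>\<^sub>m 1\<^sub>m n) * M) zs (1\<^sub>m n)"
  have S: "?S ys \<in> carrier_mat n n" for ys
    using A by (induction ys) (auto intro!: mult_carrier_mat minus_carrier_mat)
  have act: "?S ys *\<^sub>v v = (\<Prod>z\<leftarrow>ys. e - z) \<cdot>\<^sub>v v" for ys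
  proof (induction ys)
    case Nil
    show ?case using v by simp
  next
    case (Cons z ys)
    have c: "A - z \<cdot>\<^sub>m 1\<^sub>m n \<in> carrier_mat n n" using A by auto
    have "(A - z \<cdot>\<^sub>m 1\<^sub>m n) *\<^sub>v v = (e - z) \<cdot>\<^sub>v v"
    proof -
      have "(z \<cdot>\<^sub>m 1\<^sub>m n) *\<^sub>v v = z \<cdot>\<^sub>v v"
        using v(1) by (intro eq_vecI) (auto simp: row_smult)
      then show ?thesis
        using A v
        by (subst minus_mult_distrib_mat_vec[of _ n n]) (auto intro!: eq_vecI simp: left_diff_distrib)
    qed
    then show ?case
      using Cons assoc_mult_mat_vec[OF c S v(1), of ys] v mult_mat_vec[OF c v(1)]
      by (simp add: smult_smult_assoc mult.commute)
  qed
  have "(\<Prod>z\<leftarrow>zs. e - z) \<cdot>\<^sub>v v = 0\<^sub>v n"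
  proof -
    have "0\<^sub>m n n *\<^sub>v v = 0\<^sub>v n" using v(1) by (intro eq_vecI) auto
    then show ?thesis using act[of zs] by (simp add: ann)
  qed
  then have "(\<Prod>z\<leftarrow>zs. e - z) = 0"
    using v by (auto simp: vec_eq_iff)
  then show ?thesis by (auto simp: prod_list_zero_iff)
qed

text \<open>
  Schur triangularisation turns the traces of all powers into power sums of one list of
  eigenvalues.
\<close>

lemma annihilated_imp_power_traces:
  fixes A :: "complex mat"
  assumes A: "A \<in> carrier_mat n n"
    and ann: "foldr (\<lambda>z M. (A - z \<cdot>\<^sub>m 1\<^sub>m n) * M) zs (1\<^sub>m n) = 0\<^sub>m n n"
  obtains es where "set es \<subseteq> set zs"
    and "\<And>r. (\<Sum>i<n. (A ^\<^sub>m r) $$ (i, i)) = (\<Sum>e\<leftarrow>es. e ^ r)"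
proof -
  obtain es where es: "char_poly A = (\<Prod>e\<leftarrow>es. [:- e, 1:])"
    using char_poly_factorized[OF A] by blast
  obtain B P Q where schur: "schur_decomposition A es = (B, P, Q)"
    by (cases "schur_decomposition A es") auto
  note sd = schur_decomposition[OF A es schur]
  have B: "B \<in> carrier_mat n n" using similar_mat_witD2[OF A] sd by blast
  have "eigenvalue A e" if "e \<in> set es" for e
    using that unfolding eigenvalue_root_char_poly[OF A] es
    by (auto simp: poly_prod_list prod_list_zero_iff)
  then have "set es \<subseteq> set zs"
    using eigenvalue_of_annihilated[OF A ann] by blast
  moreover have "(\<Sum>i<n. (A ^\<^sub>m r) $$ (i, i)) = (\<Sum>e\<leftarrow>es. e ^ r)" for r
  proof -
    have "(\<Sum>i<n. (A ^\<^sub>m r) $$ (i, i)) = (\<Sum>i<n. (B ^\<^sub>m r) $$ (i, i))"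
      using trace_similar[OF pow_carrier_mat[OF A] similar_mat_wit_pow] sd by blast
    also have "\<dots> = (\<Sum>i<n. (B $$ (i, i)) ^ r)"
      using upper_triangular_pow_diag[OF B] sd by simp
    also have "\<dots> = (\<Sum>e\<leftarrow>diag_mat B. e ^ r)"
      using B by (simp add: diag_mat_def comp_def interv_sum_list_conv_sum_set_nat lessThan_atLeast0)
    finally show ?thesis using sd by simp
  qed
  ultimately show thesis by (rule that)
qed

lemma sum_list_map_eq_sum_of_nat_count:
  fixes f :: "'a \<Rightarrow> 'b::comm_semiring_1"
  assumes "finite S" "set xs \<subseteq> S"
  shows "(\<Sum>x\<leftarrow>xs. f x) = (\<Sum>x\<in>S. of_nat (count_list xs x) * f x)"
  using assms(2)
proof (induction xs)
  case (Cons y ys)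
  have "(\<Sum>x\<in>S. of_nat (count_list (y # ys) x) * f x)
      = (\<Sum>x\<in>S. (if y = x then f x else 0) + of_nat (count_list ys x) * f x)"
    by (intro sum.cong) (auto simp: distrib_right)
  with Cons assms(1) show ?case by (simp add: sum.distrib)
qed simp

text \<open>
  The complexification of \<open>X\<close> is annihilated by the same product, and a characteristic polynomial
  always splits over \<open>\<complex>\<close>; the annihilation forces its roots to be among the real \<open>a\<^sub>j\<close>.
  Since the \<open>a\<^sub>j\<close> are distinct, grouping equal eigenvalues yields the multiplicities.
\<close>

lemma shift_prod_imp_power_traces:
  assumes X: "X \<in> carrier_mat n n" and ann: "shift_prod p n a X = 0\<^sub>m n n"
    and inj: "inj_on a {1..p + 1}"
  obtains m :: "nat \<Rightarrow> nat"
  where "\<And>r. mat_trace (X ^\<^sub>m r) = (\<Sum>j\<in>{1..p + 1}. real (m j) * a j ^ r)"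
proof -
  let ?c = "complex_of_real"
  define zs where "zs = map (\<lambda>j. a (j + 1)) [0..<p + 1]"
  let ?S = "\<lambda>zs. foldr (\<lambda>z M. (X - z \<cdot>\<^sub>m 1\<^sub>m n) * M) zs (1\<^sub>m n)"
  let ?T = "\<lambda>zs. foldr (\<lambda>z M. (map_mat ?c X - z \<cdot>\<^sub>m 1\<^sub>m n) * M) zs (1\<^sub>m n)"
  have S: "?S ys \<in> carrier_mat n n" for ys
    using X by (induction ys) (auto intro!: mult_carrier_mat minus_carrier_mat)
  have T: "?T (map ?c ys) = map_mat ?c (?S ys)" for ys
  proof (induction ys)
    case Nil
    show ?case by (intro eq_matI) auto
  next
    case (Cons z ys)
    have "map_mat ?c (X - z \<cdot>\<^sub>m 1\<^sub>m n) = map_mat ?c X - ?c z \<cdot>\<^sub>m 1\<^sub>m n"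
      using X by (intro eq_matI) auto
    moreover have "X - z \<cdot>\<^sub>m 1\<^sub>m n \<in> carrier_mat n n"
      using X by auto
    ultimately show ?case
      using Cons by (simp add: of_real_hom.mat_hom_mult[OF _ S])
  qed
  have "?S zs = 0\<^sub>m n n"
    using ann by (simp add: shift_prod_def zs_def foldr_map comp_def del: upt_Suc)
  then have "?T (map ?c zs) = 0\<^sub>m n n"
    unfolding T by (intro eq_matI) auto
  then obtain es where es: "set es \<subseteq> set (map ?c zs)"
    and tr: "\<And>r. (\<Sum>i<n. (map_mat ?c X ^\<^sub>m r) $$ (i, i)) = (\<Sum>e\<leftarrow>es. e ^ r)"
    using annihilated_imp_power_traces[of "map_mat ?c X" n "map ?c zs"] X by auto
  have setzs: "set zs = a ` {1..p + 1}"
    unfolding zs_def set_map set_upt image_image[symmetric, of a Suc, unfolded Suc_eq_plus1]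
    by (simp add: image_Suc_atLeastLessThan atLeastLessThanSuc_atLeastAtMost del: upt_Suc)
  define m where "m j = count_list es (?c (a j))" for j
  have "mat_trace (X ^\<^sub>m r) = (\<Sum>j\<in>{1..p + 1}. real (m j) * a j ^ r)" for r
  proof -
    have "?c (mat_trace (X ^\<^sub>m r)) = (\<Sum>i<n. (map_mat ?c X ^\<^sub>m r) $$ (i, i))"
      using X pow_carrier_mat[OF X, of r]
      by (simp add: mat_trace_def of_real_hom.mat_hom_pow[OF X, symmetric])
    also have "\<dots> = (\<Sum>e\<leftarrow>es. e ^ r)" by (rule tr)
    also have "\<dots> = (\<Sum>e\<in>?c ` a ` {1..p + 1}. of_nat (count_list es e) * e ^ r)"
      using es setzs by (intro sum_list_map_eq_sum_of_nat_count) auto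
    also have "\<dots> = (\<Sum>j\<in>{1..p + 1}. of_nat (m j) * ?c (a j) ^ r)"
      using inj by (simp add: image_image m_def sum.reindex inj_on_def)
    also have "\<dots> = ?c (\<Sum>j\<in>{1..p + 1}. real (m j) * a j ^ r)"
      by simp
    finally show ?thesis by (simp only: of_real_eq_iff)
  qed
  then show thesis by (rule that)
qed


section \<open>Generic spectra are determined by one trace\<close>

theorem proposition4p5:
  fixes p n :: nat and k :: "nat \<Rightarrow> nat"
  assumes "p \<ge> 1"
    and "k 0 = 0"
    and "\<forall>i\<in>{0..p}. k i < k (i + 1)"
    and "k (p + 1) = n"
  shows "holds_generically {1..p + 1} (\<lambda>a.
    flag_model p k a =
      {X \<in> sym_mats n.
        shift_prod p n a X = 0\<^sub>m n n \<and>
        mat_trace X = (\<Sum>j=0..p. real (k (j + 1) - k j) * a (j + 1))})"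
proof -
  define I where "I = {1..p + 1}"
  define d where "d j = k j - k (j - 1)" for j
  have d_sum: "(\<Sum>j=0..p. real (k (j + 1) - k j) * a (j + 1) ^ r) = (\<Sum>j\<in>I. real (d j) * a j ^ r)"
    for a :: "nat \<Rightarrow> real" and r
    unfolding I_def d_def
    using sum.shift_bounds_cl_nat_ivl[of "\<lambda>j. real (k j - k (j - 1)) * a j ^ r" 0 1 p] by simp
  (* The forms separating multiplicity vectors from d, bounded by n so that they are finitely
     many, and the differences of two coordinates. *)
  define C where "C = (\<lambda>m j. real (m j) - real (d j)) ` {m \<in> I \<rightarrow>\<^sub>E {0..n}. \<exists>j\<in>I. m j \<noteq> d j}
    \<union> (\<lambda>(s, t) j. of_bool (j = s) - of_bool (j = t)) ` {(s, t) \<in> I \<times> I. s \<noteq> t}"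
  define U where "U = {a \<in> real_space I. \<forall>c\<in>C. (\<Sum>i\<in>I. c i * a i) \<noteq> 0}"
  have finI: "finite I" by (simp add: I_def)
  have "finite {(s, t) \<in> I \<times> I. s \<noteq> t}"
    by (rule finite_subset[of _ "I \<times> I"]) (use finI in auto)
  then have finC: "finite C"
    unfolding C_def
    by (intro finite_UnI finite_imageI finite_subset[OF Collect_restrict] finite_PiE finI) auto
  have open_U: "zariski_open I U"
    unfolding U_def using finC by (rule zariski_open_avoiding_hyperplanes)
  have "\<exists>i\<in>I. c i \<noteq> 0" if "c \<in> C" for c
    using that unfolding C_def by (fastforce simp: of_bool_def)
  then have U_nonempty: "U \<noteq> {}"
    using ex_point_avoiding_hyperplanes[OF finI finC] unfolding U_def by auto
  have avoids: "(\<Sum>i\<in>I. c i * a i) \<noteq> 0" if "a \<in> U" "c \<in> C" for a c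
    using that by (simp add: U_def)
  have inj: "inj_on a I" if "a \<in> U" for a
  proof (rule inj_onI, rule ccontr)
    fix s t assume st: "s \<in> I" "t \<in> I" "a s = a t" "s \<noteq> t"
    then have "(\<lambda>j. of_bool (j = s) - of_bool (j = t) :: real) \<in> C"
      unfolding C_def by force
    from avoids[OF \<open>a \<in> U\<close> this]
    have "(\<Sum>j\<in>I. (of_bool (j = s) - of_bool (j = t)) * a j) \<noteq> 0" .
    moreover have "(\<Sum>j\<in>I. (of_bool (j = s) - of_bool (j = t)) * a j) = a s - a t"
      using st finI
      by (simp add: left_diff_distrib sum_subtractf of_bool_def if_distrib[of "\<lambda>x. x * _"] cong: if_cong)
    ultimately show False using st by simp
  qed
  have flag_eq: "flag_model p k a = {X \<in> sym_mats n. shift_prod p n a X = 0\<^sub>m n n \<and>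
      mat_trace X = (\<Sum>j=0..p. real (k (j + 1) - k j) * a (j + 1))}" (is "_ = ?R")
    if "a \<in> U" for a
  proof
    show "flag_model p k a \<subseteq> ?R"
    proof
      fix X assume X: "X \<in> flag_model p k a"
      then have "X \<in> carrier_mat n n" unfolding flag_model_def Let_def assms(4) sym_mats_def by blast
      then have pow: "X ^\<^sub>m 1 = X" by simp
      have "1 \<in> {1..p}" using assms(1) by simp
      then have "mat_trace (X ^\<^sub>m 1) = (\<Sum>j=0..p. real (k (j + 1) - k j) * a (j + 1) ^ 1)"
        using X unfolding flag_model_def by (simp only: Let_def mem_Collect_eq)
      then have "mat_trace X = (\<Sum>j=0..p. real (k (j + 1) - k j) * a (j + 1))"
        unfolding pow power_one_right .
      with X show "X \<in> ?R"
        unfolding flag_model_def Let_def assms(4) by blast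
    qed
    show "?R \<subseteq> flag_model p k a"
    proof
      fix X assume X: "X \<in> ?R"
      then have X': "X \<in> carrier_mat n n" "shift_prod p n a X = 0\<^sub>m n n"
        by (auto simp: sym_mats_def)
      obtain m where m: "\<And>r. mat_trace (X ^\<^sub>m r) = (\<Sum>j\<in>I. real (m j) * a j ^ r)"
        using shift_prod_imp_power_traces[OF X'] inj[OF \<open>a \<in> U\<close>]
        unfolding I_def by blast
      (* The trace of the zeroth power bounds the multiplicities, so m is among the vectors
         that the forms in C compare with d. *)
      have "real n = (\<Sum>j\<in>I. real (m j))"
        using m[of 0] X' by (simp add: mat_trace_def)
      then have "n = (\<Sum>j\<in>I. m j)" by (simp flip: of_nat_sum)
      then have m_le: "m j \<le> n" if "j \<in> I" for j
        using member_le_sum[of j I m] that finI by auto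
      have "(\<Sum>j\<in>I. real (m j) * a j) = (\<Sum>j\<in>I. real (d j) * a j)"
        using m[of 1] X X' d_sum[of a 1] by simp
      then have zero: "(\<Sum>j\<in>I. (real (m j) - real (d j)) * a j) = 0"
        by (simp add: left_diff_distrib sum_subtractf)
      have eq: "m j = d j" if "j \<in> I" for j
      proof (rule ccontr)
        assume "m j \<noteq> d j"
        then have "(\<lambda>j. real (restrict m I j) - real (d j)) \<in> C"
          unfolding C_def using that m_le by (intro UnI1 imageI) auto
        from avoids[OF \<open>a \<in> U\<close> this]
        have "(\<Sum>j\<in>I. (real (restrict m I j) - real (d j)) * a j) \<noteq> 0" .
        with zero show False by simp
      qed
      have "mat_trace (X ^\<^sub>m r) = (\<Sum>j=0..p. real (k (j + 1) - k j) * a (j + 1) ^ r)" for r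
        unfolding m d_sum using eq by simp
      with X show "X \<in> flag_model p k a"
        unfolding flag_model_def Let_def assms(4) by blast
    qed
  qed
  show ?thesis
    using open_U U_nonempty inj flag_eq unfolding holds_generically_def I_def by blast
qed

end
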